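(* Let $u:\mathbb{Z}^d\to\mathbb{R}$, $u\not\equiv0$, satisfy $|u(k)|\le Ce^{-\alpha\|k\|_1}$ for all $k\in\mathbb{Z}^d$ with constants $C,\alpha>0$, and let $c_u\neq0$ and $I_0\in\mathbb{N}_0^d$ be as in the context. Let further $I\in\mathbb{N}_0^d$ with $I\le I_0$, and define $a:\mathbb{Z}^d\to\mathbb{Z}$ by $a(k)=k^I$. Then for all $x\in\mathbb{Z}^d$ $$\sum_{k\in\mathbb{Z}^d}a(k)\,u(x-k)=\begin{cases}0,&\text{if }I<I_0,\\ c_u,&\text{if }I=I_0.\end{cases}$$
   Context: Multi-index notation: $z^I=z_1^{i_1}\cdots z_d^{i_d}$ (with $0^0=1$), $D_z^I=\partial_{z_1}^{i_1}\cdots\partial_{z_d}^{i_d}$; for $I,J\in\mathbb{N}_0^d$, $J\le I$ means $j_r\le i_r$ for all $r$, and $J<I$ means $J\le I$ and $\|J\|_1<\|I\|_1$. $\mathbf{1}=(1,\dots,1)$. The generating function $F(z)=\sum_{k\in\mathbb{Z}^d}u(-k)z^k$ is holomorphic on $\{z\in\mathbb{C}^d:|z_j-1|<\delta\ \forall j\}$ for $\delta\in(0,1-e^{-\alpha})$ and not identically zero. $I_0\in\mathbb{N}_0^d$ is a (not necessarily unique) multi-index with $(D_z^{I_0}F)(\mathbf{1})=c_u\ne0$ and $(D_z^IF)(\mathbf{1})=0$ for all $I<I_0$; such $I_0$ exists. *)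

theory Defs
  imports "HOL-Analysis.Analysis"
begin

text \<open>
  Multi-indices are vectors of type \<open>nat ^ 'd\<close> and lattice points are vectors of type
  \<open>int ^ 'd\<close>, with \<open>d = CARD('d)\<close>. The order \<open>J \<le> I\<close> on
  vectors is the componentwise one of the library.
\<close>

definition norm1_int :: "int ^ 'd \<Rightarrow> int" where
  "norm1_int k = (\<Sum>j\<in>UNIV. \<bar>k $ j\<bar>)"

definition norm1_nat :: "nat ^ 'd \<Rightarrow> nat" where
  "norm1_nat I = (\<Sum>j\<in>UNIV. I $ j)"

definition mi_less :: "nat ^ 'd \<Rightarrow> nat ^ 'd \<Rightarrow> bool" where
  "mi_less J I \<longleftrightarrow> J \<le> I \<and> norm1_nat J < norm1_nat I"

definition mi_power :: "'a::comm_monoid_mult ^ 'd \<Rightarrow> nat ^ 'd \<Rightarrow> 'a" where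
  "mi_power z I = (\<Prod>j\<in>UNIV. (z $ j) ^ (I $ j))"

text \<open>Laurent monomials: the exponents may be negative.\<close>

definition mi_powi :: "complex ^ 'd \<Rightarrow> int ^ 'd \<Rightarrow> complex" where
  "mi_powi z k = (\<Prod>j\<in>UNIV. (z $ j) powi (k $ j))"

definition partial_deriv :: "'d \<Rightarrow> (complex ^ 'd \<Rightarrow> complex) \<Rightarrow> complex ^ 'd \<Rightarrow> complex" where
  "partial_deriv j f z = deriv (\<lambda>w. f (\<chi> i. if i = j then w else z $ i)) (z $ j)"

text \<open>
  \<open>mi_deriv I f\<close> takes the \<open>I $ j\<close>-fold partial derivative in each coordinate \<open>j\<close>.
  The linear order on the index type (whose elements play the role of \<open>1, \<dots>, d\<close>) only
  fixes the order of composition: the partial derivative in the last coordinate is applied first,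
  that in the first coordinate last.
\<close>

definition mi_deriv ::
  "nat ^ ('d::{finite,linorder}) \<Rightarrow> (complex ^ ('d::{finite,linorder}) \<Rightarrow> complex) \<Rightarrow>
   complex ^ ('d::{finite,linorder}) \<Rightarrow> complex" where
  "mi_deriv I f = foldr (\<lambda>j. partial_deriv j ^^ (I $ j)) (sorted_list_of_set UNIV) f"

text \<open>
  The sum is unconditional (equivalently, absolutely convergent). Outside the
  domain of convergence \<open>infsum\<close> has the junk value \<open>0\<close>; for an exponentially
  decaying \<open>u\<close> the series converges absolutely near the point \<open>(1, \<dots>, 1)\<close>.
\<close>

definition gen_fun :: "(int ^ 'd \<Rightarrow> real) \<Rightarrow> complex ^ 'd \<Rightarrow> complex" where
  "gen_fun u z = (\<Sum>\<^sub>\<infinity>k\<in>UNIV. complex_of_real (u (- k)) * mi_powi z k)"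

end

theory Submission
  imports Defs "HOL-Complex_Analysis.Cauchy_Integral_Formula"
begin

text \<open>
  Near \<open>1\<close> the series \<open>gen_fun u\<close> may be differentiated termwise, which gives
  \<open>mi_deriv J (gen_fun u) 1\<close> as the sum over \<open>k\<close> of \<open>u (- k)\<close> times the product of the falling
  factorials of length \<open>J $ j\<close> of the \<open>k $ j\<close>. After the substitution \<open>k \<mapsto> x + k\<close>, the polynomial
  \<open>mi_power (x + k) I\<close> in \<open>k\<close> is a linear combination of these products with \<open>J \<le> I\<close>, in which
  \<open>J = I\<close> has coefficient \<open>1\<close>. As \<open>I \<le> I\<^sub>0\<close>, all terms vanish except possibly the one with
  \<open>J = I\<^sub>0\<close>.
\<close>

section \<open>Falling factorials\<close>

definition ffact :: "'a::comm_ring_1 \<Rightarrow> nat \<Rightarrow> 'a" where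
  "ffact x n = (\<Prod>i<n. x - of_nat i)"

lemma ffact_0 [simp]: "ffact x 0 = 1"
  by (simp add: ffact_def)

lemma ffact_Suc: "ffact x (Suc n) = ffact x n * (x - of_nat n)"
  by (simp add: ffact_def)

text \<open>Induction: multiplying \<open>ffact y i\<close> by \<open>x + y\<close>, split as
  \<open>(y - i) + (x + i)\<close>, raises it to \<open>ffact y (Suc i)\<close> and adds a constant
  multiple of itself. Only the leading coefficient matters later, so the others stay
  existential.\<close>

lemma shifted_power_ffact_expansion:
  fixes x :: "'a::comm_ring_1"
  shows "\<exists>q. q n = 1 \<and> (\<forall>y. (x + y) ^ n = (\<Sum>i\<le>n. q i * ffact y i))"
proof (induction n)
  case 0
  show ?case by (rule exI[of _ "\<lambda>_. 1"]) simp
next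
  case (Suc n)
  then obtain q where q: "q n = 1" "\<And>y. (x + y) ^ n = (\<Sum>i\<le>n. q i * ffact y i)"
    by blast
  \<comment> \<open>The first summand is \<open>q\<close> shifted by one, from the raised terms; the
    guard \<open>i \<le> n\<close> is there because \<open>q (Suc n)\<close> is arbitrary.\<close>
  define p where "p i = (case i of 0 \<Rightarrow> 0 | Suc j \<Rightarrow> q j) + (if i \<le> n then q i * (x + of_nat i) else 0)" for i
  have "(x + y) ^ Suc n = (\<Sum>i\<le>Suc n. p i * ffact y i)" for y
  proof -
    have "(x + y) ^ Suc n = (\<Sum>i\<le>n. (x + y) * (q i * ffact y i))"
      by (simp add: q(2) sum_distrib_left)
    also have "\<dots> = (\<Sum>i\<le>n. q i * ffact y (Suc i) + q i * (x + of_nat i) * ffact y i)"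
      by (intro sum.cong refl) (simp add: ffact_Suc algebra_simps)
    also have "\<dots> = (\<Sum>i\<le>n. q i * ffact y (Suc i)) + (\<Sum>i\<le>n. q i * (x + of_nat i) * ffact y i)"
      by (rule sum.distrib)
    also have "(\<Sum>i\<le>n. q i * ffact y (Suc i)) =
        (\<Sum>i\<le>Suc n. (case i of 0 \<Rightarrow> 0 | Suc j \<Rightarrow> q j) * ffact y i)"
      by (subst sum.atMost_Suc_shift) simp
    also have "(\<Sum>i\<le>n. q i * (x + of_nat i) * ffact y i) =
        (\<Sum>i\<le>Suc n. (if i \<le> n then q i * (x + of_nat i) else 0) * ffact y i)"
      by simp
    finally show ?thesis
      by (simp only: p_def distrib_right sum.distrib)
  qed
  moreover have "p (Suc n) = 1"
    by (simp add: p_def q)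
  ultimately show ?case by blast
qed

lemma of_int_mi_power: "(of_int (mi_power k I) :: 'a::comm_ring_1) = (\<Prod>j\<in>UNIV. of_int (k $ j) ^ (I $ j))"
  by (simp add: mi_power_def)

lemma mi_power_ffact_expansion:
  fixes x :: "int ^ 'd::finite" and I :: "nat ^ 'd"
  shows "\<exists>q :: nat ^ 'd \<Rightarrow> 'a::comm_ring_1. q I = 1 \<and> (\<forall>k. of_int (mi_power (x + k) I) =
           (\<Sum>J\<in>{J. J \<le> I}. q J * (\<Prod>j\<in>UNIV. ffact (of_int (k $ j)) (J $ j))))"
proof -
  have "\<exists>q. \<forall>j. q j (I $ j) = 1 \<and>
      (\<forall>y. (of_int (x $ j) + y :: 'a) ^ (I $ j) = (\<Sum>i\<le>I $ j. q j i * ffact y i))"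
    by (intro choice allI shifted_power_ffact_expansion)
  then obtain q :: "'d \<Rightarrow> nat \<Rightarrow> 'a" where q: "\<And>j. q j (I $ j) = 1"
      "\<And>j y. (of_int (x $ j) + y) ^ (I $ j) = (\<Sum>i\<le>I $ j. q j i * ffact y i)"
    by blast
  have "of_int (mi_power (x + k) I) = (\<Sum>J\<in>{J. J \<le> I}.
      (\<Prod>j\<in>UNIV. q j (J $ j)) * (\<Prod>j\<in>UNIV. ffact (of_int (k $ j)) (J $ j)))" for k
  proof -
    have "of_int (mi_power (x + k) I) =
        (\<Prod>j\<in>UNIV. \<Sum>i\<le>I $ j. q j i * ffact (of_int (k $ j)) i)"
      by (simp add: of_int_mi_power q)
    \<comment> \<open>Multiplying out picks one exponent per coordinate; these choices are exactly
      the multi-indices \<open>J \<le> I\<close>.\<close>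
    also have "\<dots> = (\<Sum>g\<in>PiE UNIV (\<lambda>j. {..I $ j}).
        \<Prod>j\<in>UNIV. q j (g j) * ffact (of_int (k $ j)) (g j))"
      by (rule prod_sum_PiE) auto
    also have "\<dots> = (\<Sum>J\<in>{J. J \<le> I}.
        \<Prod>j\<in>UNIV. q j (J $ j) * ffact (of_int (k $ j)) (J $ j))"
      by (rule sum.reindex_bij_witness[of _ vec_nth vec_lambda])
         (auto simp: less_eq_vec_def)
    finally show ?thesis by (simp add: prod.distrib)
  qed
  then show ?thesis
    by (intro exI[of _ "\<lambda>J. \<Prod>j\<in>UNIV. q j (J $ j)"]) (simp add: q)
qed

section \<open>Derivatives of Laurent monomials\<close>

text \<open>The \<open>n\<close>-th derivative of \<open>w powi m\<close> at
  \<open>w \<noteq> 0\<close>, in a closed form that covers negative \<open>m\<close>. At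
  \<open>w = 1\<close> only the falling factorial is left.\<close>

definition laurent_mono_deriv :: "nat \<Rightarrow> int \<Rightarrow> complex \<Rightarrow> complex" where
  "laurent_mono_deriv n m w = ffact (of_int m) n * w powi (m - int n)"

lemma has_field_derivative_laurent_mono_deriv:
  assumes "w \<noteq> 0"
  shows "(laurent_mono_deriv n m has_field_derivative laurent_mono_deriv (Suc n) m w) (at w)"
proof -
  have "((\<lambda>w. ffact (of_int m) n * w powi (m - int n)) has_field_derivative
      ffact (of_int m) n * (of_int (m - int n) * w powi (m - int n - 1) * 1)) (at w)"
    using assms by (intro DERIV_cmult DERIV_power_int DERIV_ident) auto
  then show ?thesis
    by (simp add: laurent_mono_deriv_def[abs_def] ffact_Suc algebra_simps)
qed

lemma norm_ffact_le:
  fixes x :: "'a::{real_normed_field}"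
  shows "norm (ffact x n) \<le> (norm x + n) ^ n"
proof -
  have "norm (ffact x n) = (\<Prod>i<n. norm (x - of_nat i))"
    by (simp add: ffact_def prod_norm)
  also have "\<dots> \<le> (\<Prod>i<n. norm x + n)"
  proof (rule prod_mono, safe)
    fix i assume "i < n"
    have "norm (x - of_nat i) \<le> norm x + norm (of_nat i :: 'a)"
      by (rule norm_triangle_ineq4)
    with \<open>i < n\<close> show "norm (x - of_nat i) \<le> norm x + n" by simp
  qed auto
  finally show ?thesis by simp
qed

text \<open>Up to the factor \<open>fact n\<close>, the left side is a single term of the
  exponential series, whose terms are all nonnegative.\<close>

lemma power_le_fact_exp:
  assumes "x \<ge> (0::real)"
  shows "x ^ n \<le> fact n * exp x"
proof -
  have "(\<Sum>i\<in>{n}. inverse (fact i) * x ^ i) \<le> exp x"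
    unfolding exp_def using assms summable_exp[of x]
    by (intro order.trans[OF sum_le_suminf[of "\<lambda>i. inverse (fact i) * x ^ i"]])
       (auto simp: scaleR_conv_of_real)
  then show ?thesis by (simp add: field_simps)
qed

text \<open>The annulus is symmetric under inversion: \<open>w\<close> and \<open>inverse w\<close>
  both have norm at most \<open>exp \<beta>\<close>, which settles both signs of
  \<open>p\<close>.\<close>

lemma norm_powi_le_exp:
  fixes w :: "'a::real_normed_div_algebra"
  assumes "exp (- \<beta>) \<le> norm w" "norm w \<le> exp \<beta>"
  shows "norm (w powi p) \<le> exp (\<beta> * \<bar>of_int p\<bar>)"
proof (cases p rule: int_cases2)
  case (nonneg n)
  have "norm w ^ n \<le> exp \<beta> ^ n"
    using assms by (intro power_mono) auto
  then show ?thesis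
    by (simp add: nonneg norm_power exp_of_nat_mult[symmetric] mult.commute)
next
  case (nonpos n)
  have "0 < norm w"
    using assms(1) by (meson exp_gt_zero less_le_trans)
  then have "inverse (norm w) \<le> exp \<beta>"
    using assms(1) by (metis exp_gt_zero exp_minus inverse_inverse_eq le_imp_inverse_le)
  then have "inverse (norm w) ^ n \<le> exp \<beta> ^ n"
    by (intro power_mono) auto
  then show ?thesis
    by (simp add: nonpos norm_power norm_inverse power_int_minus exp_of_nat_mult[symmetric]
        power_inverse mult.commute)
qed

text \<open>The falling factorial grows only polynomially in \<open>m\<close> and costs one factor
  \<open>exp (\<beta> * \<bar>m\<bar>)\<close>, the power of \<open>w\<close> another. A majorant
  needs \<open>K\<close> to be independent of \<open>m\<close> and \<open>w\<close>.\<close>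

lemma laurent_mono_deriv_bound:
  assumes "\<beta> > 0"
  obtains K where "K \<ge> 0" "\<And>m w. exp (- \<beta>) \<le> norm w \<Longrightarrow> norm w \<le> exp \<beta> \<Longrightarrow>
      norm (laurent_mono_deriv n m w) \<le> K * exp (2 * \<beta> * \<bar>of_int m\<bar>)"
proof
  show "0 \<le> fact n / \<beta> ^ n * exp (2 * \<beta> * n)"
    using assms by simp
  fix m :: int and w :: complex
  assume w: "exp (- \<beta>) \<le> norm w" "norm w \<le> exp \<beta>"
  \<comment> \<open>Besides the falling factorial, \<open>t\<close> controls the exponent, as it
    dominates \<open>\<bar>m - n\<bar>\<close>. The surplus \<open>n\<close> ends up in the constant
    as \<open>exp (2 * \<beta> * n)\<close>.\<close>
  define t where "t = \<bar>of_int m\<bar> + real n"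
  have "norm (ffact (of_int m :: complex) n) \<le> t ^ n"
    using norm_ffact_le[of "of_int m :: complex" n] by (simp add: t_def)
  \<comment> \<open>Rescaling lets the exponential bound apply with rate \<open>\<beta>\<close>
    instead of 1, at the price of \<open>\<beta> ^ n\<close> in the denominator.\<close>
  also have "\<dots> = (\<beta> * t) ^ n / \<beta> ^ n"
    using assms by (simp add: power_mult_distrib)
  also have "\<dots> \<le> fact n * exp (\<beta> * t) / \<beta> ^ n"
    using assms by (intro divide_right_mono power_le_fact_exp) (auto simp: t_def)
  finally have 1: "norm (ffact (of_int m :: complex) n) \<le> fact n * exp (\<beta> * t) / \<beta> ^ n" .
  have "norm (w powi (m - int n)) \<le> exp (\<beta> * \<bar>of_int (m - int n)\<bar>)"
    by (rule norm_powi_le_exp[OF w])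
  also have "\<dots> \<le> exp (\<beta> * t)"
    using assms by (auto simp: t_def)
  finally have 2: "norm (w powi (m - int n)) \<le> exp (\<beta> * t)" .
  have "norm (laurent_mono_deriv n m w) \<le> (fact n * exp (\<beta> * t) / \<beta> ^ n) * exp (\<beta> * t)"
    unfolding laurent_mono_deriv_def norm_mult using 1 2 assms
    by (intro mult_mono) auto
  also have "\<dots> = fact n / \<beta> ^ n * exp (2 * \<beta> * n) * exp (2 * \<beta> * \<bar>of_int m\<bar>)"
    by (simp add: t_def exp_add[symmetric] field_simps)
  finally show "norm (laurent_mono_deriv n m w) \<le>
      fact n / \<beta> ^ n * exp (2 * \<beta> * n) * exp (2 * \<beta> * \<bar>of_int m\<bar>)" .
qed

section \<open>Summation over the integer lattice\<close>

lemma summable_exp_abs_int: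
  assumes "\<beta> > (0::real)"
  shows "(\<lambda>m::int. exp (- \<beta> * \<bar>of_int m\<bar>)) summable_on UNIV"
proof -
  let ?f = "\<lambda>m::int. exp (- \<beta> * \<bar>of_int m\<bar>)"
  have "summable (\<lambda>n::nat. exp (- \<beta>) ^ n)"
    using assms by (intro summable_geometric) auto
  moreover have "exp (- \<beta> * real n) = exp (- \<beta>) ^ n" for n
    by (metis exp_of_nat_mult mult.commute)
  ultimately have nat: "(\<lambda>n::nat. exp (- \<beta> * real n)) summable_on UNIV"
    by (intro norm_summable_imp_summable_on) simp
  have "?f summable_on range int"
    using nat by (subst summable_on_reindex) (auto simp: o_def)
  moreover have "?f summable_on range (\<lambda>n. - int n)"
    using nat by (subst summable_on_reindex) (auto simp: o_def inj_on_def)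
  ultimately have "?f summable_on (range int \<union> range (\<lambda>n. - int n))"
    by (rule summable_on_union)
  also have "range int \<union> range (\<lambda>n. - int n) = UNIV"
  proof (rule UNIV_eq_I[symmetric])
    show "m \<in> range int \<union> range (\<lambda>n. - int n)" for m
      by (cases m rule: int_cases2) auto
  qed
  finally show ?thesis .
qed

text \<open>By nonnegativity summability is absolute, so the product rule for sums over function
  spaces applies; \<open>vec_nth\<close> carries it over to vectors.\<close>

lemma summable_on_prod_vec:
  fixes f :: "'d::finite \<Rightarrow> 'b::countable \<Rightarrow> real"
  assumes "\<And>j m. f j m \<ge> 0" "\<And>j. f j summable_on UNIV"
  shows "(\<lambda>k::'b ^ 'd. \<Prod>j\<in>UNIV. f j (k $ j)) summable_on UNIV"
proof -
  have "Infinite_Set_Sum.abs_summable_on (\<lambda>g. \<Prod>j\<in>UNIV. f j (g j)) (PiE UNIV (\<lambda>_. UNIV))"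
    using assms by (intro abs_summable_on_prod_PiE) (auto simp flip: abs_summable_equivalent)
  then have "(\<lambda>g. \<Prod>j\<in>UNIV. f j (g j)) summable_on UNIV"
    by (simp add: abs_summable_summable flip: abs_summable_equivalent)
  moreover have "bij_betw (vec_nth :: 'b ^ 'd \<Rightarrow> _) UNIV UNIV"
    by (rule bij_betw_byWitness[of _ vec_lambda]) auto
  ultimately show ?thesis
    using summable_on_reindex_bij_betw[of vec_nth UNIV UNIV "\<lambda>g. \<Prod>j\<in>UNIV. f j (g j)"] by simp
qed

text \<open>The Weierstrass M-test gives uniform convergence of the finite partial sums, and a
  locally uniform limit of holomorphic functions is differentiated termwise. A majorant of the
  \<open>f k\<close> suffices: convergence of the derivatives is part of the conclusion.\<close>

lemma deriv_infsum:
  fixes f f' :: "'a \<Rightarrow> complex \<Rightarrow> complex"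
  assumes "open A" "z \<in> A"
    and deriv: "\<And>k w. w \<in> A \<Longrightarrow> (f k has_field_derivative f' k w) (at w)"
    and bound: "\<And>k w. w \<in> A \<Longrightarrow> norm (f k w) \<le> M k"
    and "M summable_on UNIV"
  shows "((\<lambda>k. f' k z) has_sum deriv (\<lambda>w. \<Sum>\<^sub>\<infinity>k. f k w) z) UNIV"
proof -
  obtain r where r: "r > 0" "cball z r \<subseteq> A"
    using assms(1,2) open_contains_cball by blast
  have ul: "uniform_limit (cball z r) (\<lambda>X w. \<Sum>k\<in>X. f k w) (\<lambda>w. \<Sum>\<^sub>\<infinity>k. f k w)
      (finite_subsets_at_top UNIV)"
    using r(2) by (intro Weierstrass_m_test_general[where M = M] bound assms) auto
  have d: "((\<lambda>w. \<Sum>k\<in>X. f k w) has_field_derivative (\<Sum>k\<in>X. f' k w)) (at w)" if "w \<in> A" for X w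
    by (intro DERIV_sum deriv that)
  have ev: "\<forall>\<^sub>F X in finite_subsets_at_top UNIV. continuous_on (cball z r) (\<lambda>w. \<Sum>k\<in>X. f k w) \<and>
      (\<forall>w\<in>ball z r. ((\<lambda>w. \<Sum>k\<in>X. f k w) has_field_derivative (\<Sum>k\<in>X. f' k w)) (at w))"
  proof (intro always_eventually allI conjI ballI)
    fix X
    show "continuous_on (cball z r) (\<lambda>w. \<Sum>k\<in>X. f k w)"
      using r(2) d by (intro continuous_at_imp_continuous_on ballI) (blast intro: DERIV_isCont)
    fix w assume "w \<in> ball z r"
    then show "((\<lambda>w. \<Sum>k\<in>X. f k w) has_field_derivative (\<Sum>k\<in>X. f' k w)) (at w)"
      using r(2) by (intro d) auto
  qed
  obtain g' where "\<And>w. w \<in> ball z r \<Longrightarrow>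
      ((\<lambda>w. \<Sum>\<^sub>\<infinity>k. f k w) has_field_derivative g' w) (at w) \<and>
      ((\<lambda>X. \<Sum>k\<in>X. f' k w) \<longlongrightarrow> g' w) (finite_subsets_at_top UNIV)"
    by (rule has_complex_derivative_uniform_limit[OF ev ul _ r(1)]) auto
  from this[of z] r(1) have "((\<lambda>w. \<Sum>\<^sub>\<infinity>k. f k w) has_field_derivative g' z) (at z)"
      "((\<lambda>k. f' k z) has_sum g' z) UNIV"
    by (auto simp: has_sum_def)
  then show ?thesis
    using DERIV_imp_deriv by metis
qed

section \<open>Termwise differentiation of Laurent series\<close>

text \<open>A product of open annuli around the unit circles, the natural domain for Laurent series:
  no coordinate vanishes, and for \<open>\<beta> > 0\<close> it contains the point
  \<open>1\<close>.\<close>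

definition polyannulus :: "real \<Rightarrow> (complex ^ 'd) set" where
  "polyannulus \<beta> = {z. \<forall>j. exp (- \<beta>) < norm (z $ j) \<and> norm (z $ j) < exp \<beta>}"

definition laurent_term ::
  "(int ^ 'd \<Rightarrow> complex) \<Rightarrow> nat ^ 'd \<Rightarrow> int ^ 'd \<Rightarrow> complex ^ 'd \<Rightarrow> complex" where
  "laurent_term c J k z = c k * (\<Prod>j\<in>UNIV. laurent_mono_deriv (J $ j) (k $ j) (z $ j))"

text \<open>A priori only the formal termwise derivative; \<open>mi_deriv_laurent_deriv\<close>
  identifies it with the actual one.\<close>

definition laurent_deriv ::
  "(int ^ 'd \<Rightarrow> complex) \<Rightarrow> nat ^ 'd \<Rightarrow> complex ^ 'd \<Rightarrow> complex" where
  "laurent_deriv c J z = (\<Sum>\<^sub>\<infinity>k. laurent_term c J k z)"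

lemma norm1_int_exp:
  "exp (- \<beta> * real_of_int (norm1_int k)) = (\<Prod>j\<in>UNIV. exp (- \<beta> * \<bar>of_int (k $ j)\<bar>))"
  by (simp add: norm1_int_def exp_sum[symmetric] sum_distrib_left sum_negf)

text \<open>
  One third of the decay rate absorbs the powers of \<open>z\<close>, one third the falling factorials, and
  the last third makes the series summable.
\<close>

lemma laurent_term_bound:
  fixes c :: "int ^ 'd::finite \<Rightarrow> complex"
  assumes "\<beta> > 0" "\<And>k. norm (c k) \<le> C * exp (- (3 * \<beta>) * real_of_int (norm1_int k))"
  obtains M where "M summable_on UNIV"
    "\<And>k z. z \<in> polyannulus \<beta> \<Longrightarrow> norm (laurent_term c J k z) \<le> M k"
proof -
  have "\<exists>K\<ge>0. \<forall>m w. exp (- \<beta>) \<le> norm w \<longrightarrow> norm w \<le> exp \<beta> \<longrightarrow>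
      norm (laurent_mono_deriv (J $ j) m w) \<le> K * exp (2 * \<beta> * \<bar>of_int m\<bar>)" for j
    using laurent_mono_deriv_bound[OF assms(1), of "J $ j"] by metis
  then obtain K where K: "\<And>j. K j \<ge> 0"
      "\<And>j m w. exp (- \<beta>) \<le> norm w \<Longrightarrow> norm w \<le> exp \<beta> \<Longrightarrow>
        norm (laurent_mono_deriv (J $ j) m w) \<le> K j * exp (2 * \<beta> * \<bar>of_int m\<bar>)"
    by metis
  define M where "M k = C * (\<Prod>j\<in>UNIV. K j * exp (- \<beta> * \<bar>of_int (k $ j)\<bar>))" for k :: "int ^ 'd"
  show thesis
  proof
    show "M summable_on UNIV"
      unfolding M_def using K(1) assms(1)
      by (intro summable_on_cmult_right summable_on_prod_vec summable_exp_abs_int) auto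
    fix k and z :: "complex ^ 'd" assume z: "z \<in> polyannulus \<beta>"
    have "norm (laurent_term c J k z) =
        norm (c k) * (\<Prod>j\<in>UNIV. norm (laurent_mono_deriv (J $ j) (k $ j) (z $ j)))"
      by (simp add: laurent_term_def norm_mult prod_norm)
    \<comment> \<open>\<open>mult_mono\<close> needs the first bound to be nonnegative, which
      follows from the decay hypothesis because it dominates a norm.\<close>
    also have "\<dots> \<le> (C * (\<Prod>j\<in>UNIV. exp (- (3 * \<beta>) * \<bar>of_int (k $ j)\<bar>))) *
        (\<Prod>j\<in>UNIV. K j * exp (2 * \<beta> * \<bar>of_int (k $ j)\<bar>))"
      using z assms(2)[of k] order.trans[OF norm_ge_zero assms(2)[of k]]
      unfolding norm1_int_exp
      by (intro mult_mono prod_mono) (auto intro!: K(2) prod_nonneg simp: polyannulus_def less_imp_le)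
    also have "\<dots> = C * (\<Prod>j\<in>UNIV. exp (- (3 * \<beta>) * \<bar>of_int (k $ j)\<bar>) *
        (K j * exp (2 * \<beta> * \<bar>of_int (k $ j)\<bar>)))"
      by (simp add: prod.distrib)
    also have "\<dots> = M k"
      unfolding M_def
      by (intro arg_cong[where f = "(*) C"] prod.cong refl)
         (simp add: exp_add[symmetric] algebra_simps)
    finally show "norm (laurent_term c J k z) \<le> M k" .
  qed
qed

text \<open>Varying coordinate \<open>j\<close> affects a single factor of the product, whose order
  of differentiation goes up by one.\<close>

lemma laurent_term_has_field_derivative:
  fixes z :: "complex ^ 'd::finite"
  assumes "w \<noteq> 0"
  shows "((\<lambda>w. laurent_term c J k (\<chi> i. if i = j then w else z $ i)) has_field_derivative
    laurent_term c (J + axis j 1) k (\<chi> i. if i = j then w else z $ i)) (at w)"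
proof -
  have split: "laurent_term c L k (\<chi> i. if i = j then w else z $ i) =
      (c k * (\<Prod>i\<in>UNIV - {j}. laurent_mono_deriv (L $ i) (k $ i) (z $ i))) *
      laurent_mono_deriv (L $ j) (k $ j) w" for L w
    unfolding laurent_term_def by (subst prod.remove[of _ j]) (auto intro!: prod.cong)
  have "(\<Prod>i\<in>UNIV - {j}. laurent_mono_deriv ((J + axis j 1) $ i) (k $ i) (z $ i)) =
      (\<Prod>i\<in>UNIV - {j}. laurent_mono_deriv (J $ i) (k $ i) (z $ i))"
    by (intro prod.cong) (auto simp: axis_def)
  moreover have "(J + axis j 1) $ j = Suc (J $ j)"
    by (simp add: axis_def)
  ultimately show ?thesis
    unfolding split using has_field_derivative_laurent_mono_deriv[OF assms]
    by (simp only:) (rule DERIV_cmult)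
qed

context
  fixes c :: "int ^ 'd::{finite,linorder} \<Rightarrow> complex" and C \<beta> :: real
  assumes beta: "\<beta> > 0"
    and decay: "\<And>k. norm (c k) \<le> C * exp (- (3 * \<beta>) * real_of_int (norm1_int k))"
begin

text \<open>Agreement of \<open>f\<close> with the series is asked only on the polyannulus, which is
  all that is known after one differentiation; thus the lemma can be iterated.\<close>

lemma partial_deriv_laurent_deriv:
  assumes f: "\<And>z. z \<in> polyannulus \<beta> \<Longrightarrow> f z = laurent_deriv c J z" and z: "z \<in> polyannulus \<beta>"
  shows "partial_deriv j f z = laurent_deriv c (J + axis j 1) z"
proof -
  define A where "A = {w::complex. exp (- \<beta>) < norm w \<and> norm w < exp \<beta>}"
  have A: "open A" "z $ j \<in> A"
    using z unfolding A_def polyannulus_def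
    by (auto intro!: open_Collect_conj open_Collect_less continuous_intros)
  let ?upd = "\<lambda>w. \<chi> i. if i = j then w else z $ i"
  have upd: "?upd w \<in> polyannulus \<beta>" if "w \<in> A" for w
    using that z by (auto simp: A_def polyannulus_def)
  obtain M where "M summable_on UNIV"
      "\<And>k z. z \<in> polyannulus \<beta> \<Longrightarrow> norm (laurent_term c J k z) \<le> M k"
    using laurent_term_bound[OF beta decay] by blast
  then have "((\<lambda>k. laurent_term c (J + axis j 1) k (?upd (z $ j))) has_sum
      deriv (\<lambda>w. \<Sum>\<^sub>\<infinity>k. laurent_term c J k (?upd w)) (z $ j)) UNIV"
    using A upd
    by (intro deriv_infsum[of A _ _ _ M] laurent_term_has_field_derivative) (auto simp: A_def)
  moreover have "?upd (z $ j) = z"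
    by (simp add: vec_eq_iff)
  ultimately have "deriv (\<lambda>w. laurent_deriv c J (?upd w)) (z $ j) = laurent_deriv c (J + axis j 1) z"
    unfolding laurent_deriv_def by (simp add: infsumI)
  \<comment> \<open>\<open>deriv\<close> depends only on values near the point, and \<open>A\<close>
    is open.\<close>
  moreover have "\<forall>\<^sub>F w in nhds (z $ j). f (?upd w) = laurent_deriv c J (?upd w)"
    using A f upd unfolding eventually_nhds by blast
  ultimately show ?thesis
    unfolding partial_deriv_def by (simp add: deriv_cong_ev)
qed

lemma partial_deriv_funpow_laurent_deriv:
  assumes "\<And>z. z \<in> polyannulus \<beta> \<Longrightarrow> f z = laurent_deriv c J z" and "z \<in> polyannulus \<beta>"
  shows "(partial_deriv j ^^ n) f z = laurent_deriv c (J + axis j n) z"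
  using assms(2)
proof (induction n arbitrary: z)
  case 0
  have "J + axis j 0 = J" by (simp add: vec_eq_iff axis_def)
  with assms(1)[OF 0] show ?case by (simp only: funpow_0)
next
  case (Suc n)
  have "J + axis j n + axis j 1 = J + axis j (Suc n)"
    by (simp add: vec_eq_iff axis_def)
  then show ?case
    using partial_deriv_laurent_deriv[OF Suc.IH Suc.prems, of j] by simp
qed

lemma mi_deriv_laurent_deriv:
  assumes f: "\<And>z. z \<in> polyannulus \<beta> \<Longrightarrow> f z = laurent_deriv c 0 z" and z: "z \<in> polyannulus \<beta>"
  shows "mi_deriv I f z = laurent_deriv c I z"
proof -
  \<comment> \<open>Induction needs arbitrary lists. The sorted list enters only below: it contains
    each coordinate exactly once, so the orders add up to \<open>I\<close>.\<close>
  have "foldr (\<lambda>j. partial_deriv j ^^ (I $ j)) xs f z =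
      laurent_deriv c (\<Sum>j\<leftarrow>xs. axis j (I $ j)) z" if "z \<in> polyannulus \<beta>" for xs z
    using that
  proof (induction xs arbitrary: z)
    case (Cons j xs)
    then show ?case
      using partial_deriv_funpow_laurent_deriv[OF Cons.IH Cons.prems, where j = j and n = "I $ j"]
      by (simp add: add.commute)
  qed (simp add: f)
  moreover have "(\<Sum>j\<leftarrow>sorted_list_of_set UNIV. axis j (I $ j)) = I"
    by (subst sum_list_distinct_conv_sum_set) (auto simp: vec_eq_iff axis_def)
  ultimately show ?thesis
    using z by (simp add: mi_deriv_def)
qed

text \<open>The majorant gives absolute convergence, so the \<open>infsum\<close> in
  \<open>laurent_deriv\<close> is a genuine sum and not the default value 0.\<close>

lemma has_sum_laurent_deriv:
  assumes "z \<in> polyannulus \<beta>"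
  shows "((\<lambda>k. laurent_term c J k z) has_sum laurent_deriv c J z) UNIV"
proof -
  obtain M where M: "M summable_on UNIV"
      "\<And>k z. z \<in> polyannulus \<beta> \<Longrightarrow> norm (laurent_term c J k z) \<le> M k"
    using laurent_term_bound[OF beta decay] by blast
  have "(\<lambda>k. norm (laurent_term c J k z)) summable_on UNIV"
    using M assms by (intro summable_on_comparison_test[OF M(1)]) auto
  then show ?thesis
    unfolding laurent_deriv_def by (rule has_sum_infsum[OF abs_summable_summable])
qed

end

lemma has_sum_mi_deriv_gen_fun:
  fixes u :: "int ^ ('d::{finite,linorder}) \<Rightarrow> real"
  assumes "\<alpha> > 0" and "\<And>k. \<bar>u k\<bar> \<le> C * exp (- \<alpha> * real_of_int (norm1_int k))"
  shows "((\<lambda>k. complex_of_real (u (- k)) * (\<Prod>j\<in>UNIV. ffact (of_int (k $ j)) (J $ j)))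
    has_sum mi_deriv J (gen_fun u) 1) UNIV"
proof -
  define c where "c k = complex_of_real (u (- k))" for k
  define \<beta> where "\<beta> = \<alpha> / 3"
  have beta: "\<beta> > 0" using assms(1) by (simp add: \<beta>_def)
  have decay: "norm (c k) \<le> C * exp (- (3 * \<beta>) * real_of_int (norm1_int k))" for k
    using assms(2)[of "- k"] by (simp add: c_def \<beta>_def norm1_int_def)
  have one: "1 \<in> polyannulus \<beta>"
    using beta by (simp add: polyannulus_def)
  \<comment> \<open>This holds for every \<open>z\<close>, since both sides are
    \<open>infsum\<close> of the same terms.\<close>
  have "gen_fun u z = laurent_deriv c 0 z" for z
    by (simp add: laurent_deriv_def gen_fun_def laurent_term_def
        laurent_mono_deriv_def mi_powi_def c_def)
  then have "mi_deriv J (gen_fun u) 1 = laurent_deriv c J 1"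
    by (intro mi_deriv_laurent_deriv[OF beta decay] one) auto
  then show ?thesis
    using has_sum_laurent_deriv[OF beta decay one, of J]
    by (simp add: laurent_term_def laurent_mono_deriv_def c_def[abs_def])
qed

section \<open>Evaluation of the convolution\<close>

lemma has_sum_sum:
  fixes f :: "'i \<Rightarrow> 'a \<Rightarrow> 'b::topological_comm_monoid_add"
  assumes "\<And>i. i \<in> S \<Longrightarrow> (f i has_sum s i) A"
  shows "((\<lambda>k. \<Sum>i\<in>S. f i k) has_sum (\<Sum>i\<in>S. s i)) A"
  using assms by (induction S rule: infinite_finite_induct) (auto intro: has_sum_add)

lemma mi_less_or_eq:
  fixes I J :: "nat ^ 'd::finite"
  assumes "J \<le> I"
  shows "mi_less J I \<or> J = I"
proof (cases "J = I")
  case False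
  then obtain j where "J $ j \<noteq> I $ j" by (auto simp: vec_eq_iff)
  with assms have "norm1_nat J < norm1_nat I"
    unfolding norm1_nat_def
    by (intro sum_strict_mono_ex1) (auto simp: less_eq_vec_def intro: exI[of _ j] le_neq_trans)
  with assms show ?thesis by (simp add: mi_less_def)
qed simp

theorem proposition4p1:
  fixes u :: "int ^ ('d::{finite,linorder}) \<Rightarrow> real"
    and C \<alpha> :: real
    and c_u :: complex
    and I\<^sub>0 I :: "nat ^ ('d::{finite,linorder})"
    and a :: "int ^ ('d::{finite,linorder}) \<Rightarrow> int"
    and x :: "int ^ ('d::{finite,linorder})"
  assumes "u \<noteq> (\<lambda>k. 0)"
    and "C > 0" and "\<alpha> > 0"
    and "\<And>k. \<bar>u k\<bar> \<le> C * exp (- \<alpha> * real_of_int (norm1_int k))"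
    and "mi_deriv I\<^sub>0 (gen_fun u) 1 = c_u" and "c_u \<noteq> 0"
    and "\<And>J. mi_less J I\<^sub>0 \<Longrightarrow> mi_deriv J (gen_fun u) 1 = 0"
    and "I \<le> I\<^sub>0"
    and "\<And>k. a k = mi_power k I"
  shows "(mi_less I I\<^sub>0 \<longrightarrow>
             ((\<lambda>k. complex_of_real (of_int (a k) * u (x - k))) has_sum 0) UNIV) \<and>
         (I = I\<^sub>0 \<longrightarrow>
             ((\<lambda>k. complex_of_real (of_int (a k) * u (x - k))) has_sum c_u) UNIV)"
proof -
  obtain q :: "nat ^ ('d::{finite,linorder}) \<Rightarrow> complex" where q: "q I = 1"
      "\<And>k. of_int (mi_power (x + k) I) =
        (\<Sum>J\<in>{J. J \<le> I}. q J * (\<Prod>j\<in>UNIV. ffact (of_int (k $ j)) (J $ j)))"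
    using mi_power_ffact_expansion[of I x] by blast
  let ?S = "\<lambda>J. mi_deriv J (gen_fun u) 1"
  have fin: "finite {J. J \<le> I}"
  proof (rule finite_subset)
    show "{J. J \<le> I} \<subseteq> vec_lambda ` PiE UNIV (\<lambda>j. {..I $ j})"
      by (auto simp: less_eq_vec_def intro!: image_eqI[of _ _ "vec_nth _"])
  qed (auto intro!: finite_PiE)
  have "((\<lambda>k. \<Sum>J\<in>{J. J \<le> I}. q J *
      (complex_of_real (u (- k)) * (\<Prod>j\<in>UNIV. ffact (of_int (k $ j)) (J $ j))))
      has_sum (\<Sum>J\<in>{J. J \<le> I}. q J * ?S J)) UNIV"
    by (intro has_sum_sum has_sum_cmult_right has_sum_mi_deriv_gen_fun[OF assms(3,4)])
  \<comment> \<open>Since \<open>x - (x + k) = - k\<close>, the expansion folds back into the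
    convolution summand at the translated index \<open>x + k\<close>.\<close>
  also have "(\<lambda>k. \<Sum>J\<in>{J. J \<le> I}. q J *
      (complex_of_real (u (- k)) * (\<Prod>j\<in>UNIV. ffact (of_int (k $ j)) (J $ j)))) =
      (\<lambda>k. complex_of_real (of_int (a (x + k)) * u (x - (x + k))))"
    by (simp add: assms(9) q(2) sum_distrib_right sum_distrib_left mult_ac)
  also have "(\<dots> has_sum (\<Sum>J\<in>{J. J \<le> I}. q J * ?S J)) UNIV \<longleftrightarrow>
      ((\<lambda>k. complex_of_real (of_int (a k) * u (x - k))) has_sum (\<Sum>J\<in>{J. J \<le> I}. q J * ?S J)) UNIV"
    by (rule has_sum_reindex_bij_witness[of _ "\<lambda>k. k - x" "\<lambda>k. x + k"]) auto
  \<comment> \<open>Each \<open>J \<noteq> I\<close> in the range lies strictly below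
    \<open>I\<close>, hence strictly below \<open>I\<^sub>0\<close>, so its derivative vanishes.
    What remains is \<open>J = I\<close> with coefficient 1, and the hypotheses on
    \<open>I\<^sub>0\<close> evaluate it in both cases.\<close>
  also have "(\<Sum>J\<in>{J. J \<le> I}. q J * ?S J) = (\<Sum>J\<in>{J. J \<le> I}. if J = I then ?S I else 0)"
  proof (intro sum.cong refl)
    fix J assume "J \<in> {J. J \<le> I}"
    then have J: "J \<le> I" by simp
    show "q J * ?S J = (if J = I then ?S I else 0)"
    proof (cases "J = I")
      case False
      then have "norm1_nat J < norm1_nat I"
        using mi_less_or_eq[OF J] by (simp add: mi_less_def)
      also have "norm1_nat I \<le> norm1_nat I\<^sub>0"
        using assms(8) by (auto simp: norm1_nat_def less_eq_vec_def intro: sum_mono)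
      finally have "mi_less J I\<^sub>0"
        using J assms(8) by (simp add: mi_less_def)
      with False show ?thesis by (simp add: assms(7))
    qed (simp add: q(1))
  qed
  also have "\<dots> = ?S I"
    using fin by simp
  finally show ?thesis
    using assms(5,7) by auto
qed

end
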